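(* For $q\in(0,1)$ let $$\epsilon=\epsilon(q)=\left\lceil \frac{q}{1-q}\right\rceil-\frac{q}{1-q},\qquad k_q=\frac{q}{1-q}+\epsilon .$$ Then, as $\epsilon$ approaches $0$ from above (remaining strictly positive), the performance ratio of the recruiting game $G_{k_q,q}(x,x)$ converges to $\frac{2q}{1+q}$; that is, for every $\delta>0$ there is $\epsilon_0>0$ such that for every $q\in(0,1)$ with $0<\epsilon(q)<\epsilon_0$ and every positive integer $x$, the performance ratio of $G_{k_q,q}(x,x)$ differs from $\frac{2q}{1+q}$ by less than $\delta$.
   Context: Recruiting game. For an integer $k\ge 1$, a real $q\in(0,1)$ and positive integers $x_1,x_2$, the game $G_{k,q}(x_1,x_2)$ (also written $G_k(x_1,x_2)$) is played by two players over $k$ rounds; player $i$ has initial reputation $x_i$. In each round there are two candidates, the stronger one of quality $1$ and the weaker one of quality $q$. Knowing the outcomes of all previous rounds, the players simultaneously each choose one candidate to make an offer to. If they choose different candidates, each player hires the candidate it chose. If they choose the same candidate, player 1 hires it with probability $\frac{x_1}{x_1+x_2}$ and player 2 hires it with probability $\frac{x_2}{x_1+x_2}$, where $x_1,x_2$ are the current reputations; the player who loses hires no one in that round. A player's payoff in a round is the quality of the candidate it hires ($0$ if none). Its reputation increases by $1$ if it hired the stronger candidate and is unchanged otherwise. A player's utility is its total expected payoff over the $k$ rounds. Canonical strategies. At any point the higher player is the one with larger current reputation (player 1 in case of equality) and the other is the lower player. The strategies $s_k(x_1,x_2)$ are defined by backward induction: in every round the higher player makes an offer to the stronger candidate, and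 the lower player chooses the candidate maximizing its own expected total utility from the current and all later rounds, given that the later rounds are played according to these strategies; if indifferent, the lower player chooses the weaker candidate. Let $u_i(s_k(x_1,x_2))$ be player $i$'s expected utility under these strategies, and $u(s_k(x_1,x_2))=u_1(s_k(x_1,x_2))+u_2(s_k(x_1,x_2))$ the expected social welfare. Performance ratio. The maximum possible social welfare is $k(1+q)$, and the performance ratio of $G_{k,q}(x_1,x_2)$ is $\dfrac{u(s_k(x_1,x_2))}{k(1+q)}$. *)

theory Defs
  imports "HOL-Probability.Probability"
begin

datatype player = P1 | P2

primrec opponent :: "player \<Rightarrow> player" where
  "opponent P1 = P2"
| "opponent P2 = P1"

datatype candidate = Stronger | Weaker

primrec quality :: "real \<Rightarrow> candidate \<Rightarrow> real" where
  "quality q Stronger = 1"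
| "quality q Weaker = q"

type_synonym reputation = "player \<Rightarrow> nat"

text \<open>
  The outcome of a round records whom each player hires (\<^term>\<open>None\<close>: nobody). It also reveals both
  offers: some player hires nobody exactly when both made an offer to the candidate the other hires.
\<close>
type_synonym outcome = "player \<Rightarrow> candidate option"

text \<open>The outcomes of all previous rounds, the earliest one first.\<close>
type_synonym history = "outcome list"

text \<open>The pure strategies of both players: each offer may depend on the whole history.\<close>
type_synonym profile = "history \<Rightarrow> player \<Rightarrow> candidate"

definition winner_pmf :: "reputation \<Rightarrow> player pmf" where
  "winner_pmf x =
     map_pmf (\<lambda>b. if b then P1 else P2) (bernoulli_pmf (real (x P1) / (real (x P1) + real (x P2))))"

definition round_pmf :: "reputation \<Rightarrow> (player \<Rightarrow> candidate) \<Rightarrow> outcome pmf" where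
  "round_pmf x a =
     (if a P1 \<noteq> a P2 then return_pmf (\<lambda>i. Some (a i))
      else map_pmf (\<lambda>w i. if i = w then Some (a i) else None) (winner_pmf x))"

definition payoff :: "real \<Rightarrow> outcome \<Rightarrow> player \<Rightarrow> real" where
  "payoff q w i = (case w i of None \<Rightarrow> 0 | Some c \<Rightarrow> quality q c)"

definition update :: "reputation \<Rightarrow> outcome \<Rightarrow> reputation" where
  "update x w = (\<lambda>i. if w i = Some Stronger then x i + 1 else x i)"

text \<open>
  Distribution of the complete history of the \<^term>\<open>k\<close>-round game with initial reputations
  \<^term>\<open>x\<close>. After the first outcome \<^term>\<open>w\<close>, what remains is the \<open>(k - 1)\<close>-round game with
  the updated reputations and the profile restricted to the histories starting with \<^term>\<open>w\<close>.
\<close>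
primrec play :: "nat \<Rightarrow> reputation \<Rightarrow> profile \<Rightarrow> history pmf" where
  "play 0 x s = return_pmf []"
| "play (Suc k) x s =
     bind_pmf (round_pmf x (s []))
       (\<lambda>w. map_pmf (\<lambda>h. w # h) (play k (update x w) (\<lambda>h. s (w # h))))"

definition utility :: "real \<Rightarrow> nat \<Rightarrow> reputation \<Rightarrow> profile \<Rightarrow> player \<Rightarrow> real" where
  "utility q k x s i = measure_pmf.expectation (play k x s) (\<lambda>h. \<Sum>w\<leftarrow>h. payoff q w i)"

definition higher :: "reputation \<Rightarrow> player" where
  "higher x = (if x P1 \<ge> x P2 then P1 else P2)"

definition lower :: "reputation \<Rightarrow> player" where
  "lower x = opponent (higher x)"

text \<open>Play \<^term>\<open>a\<close> in the first round; after its outcome \<^term>\<open>w\<close>, follow \<^term>\<open>t w\<close>.\<close>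
definition first_then :: "(player \<Rightarrow> candidate) \<Rightarrow> (outcome \<Rightarrow> profile) \<Rightarrow> profile" where
  "first_then a t h = (case h of [] \<Rightarrow> a | w # h' \<Rightarrow> t w h')"

definition offers :: "reputation \<Rightarrow> candidate \<Rightarrow> player \<Rightarrow> candidate" where
  "offers x c = (\<lambda>i. if i = higher x then Stronger else c)"

text \<open>
  In the first of \<^term>\<open>k\<close> rounds, the lower player's best candidate when \<^term>\<open>t w\<close> is played from
  the next round on, ties being broken in favour of the weaker candidate.
\<close>
definition lower_choice :: "real \<Rightarrow> nat \<Rightarrow> reputation \<Rightarrow> (outcome \<Rightarrow> profile) \<Rightarrow> candidate" where
  "lower_choice q k x t =
     (let v = (\<lambda>c. utility q k x (first_then (offers x c) t) (lower x))
      in if v Stronger > v Weaker then Stronger else Weaker)"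

text \<open>
  The canonical strategies \<open>s\<^sub>k(x)\<close>. Offers after \<^term>\<open>k\<close> or more rounds are irrelevant in
  the \<^term>\<open>k\<close>-round game, so the value for \<open>k = 0\<close> is arbitrary.
\<close>
primrec canonical :: "real \<Rightarrow> nat \<Rightarrow> reputation \<Rightarrow> profile" where
  "canonical q 0 x = (\<lambda>h i. Weaker)"
| "canonical q (Suc k) x =
     (let t = (\<lambda>w. canonical q k (update x w))
      in first_then (offers x (lower_choice q (Suc k) x t)) t)"

definition social_welfare :: "real \<Rightarrow> nat \<Rightarrow> reputation \<Rightarrow> profile \<Rightarrow> real" where
  "social_welfare q k x s = utility q k x s P1 + utility q k x s P2"

definition initial :: "nat \<Rightarrow> nat \<Rightarrow> reputation" where
  "initial x1 x2 = case_player x1 x2"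

text \<open>In each round the two hires are worth at most \<open>1 + q\<close> in total, hence the denominator.\<close>
definition performance_ratio :: "nat \<Rightarrow> real \<Rightarrow> nat \<Rightarrow> nat \<Rightarrow> real" where
  "performance_ratio k q x1 x2 =
     social_welfare q k (initial x1 x2) (canonical q k (initial x1 x2)) / (real k * (1 + q))"

definition eps :: "real \<Rightarrow> real" where
  "eps q = real_of_int \<lceil>q / (1 - q)\<rceil> - q / (1 - q)"

text \<open>The number \<open>q / (1 - q) + eps q\<close> is a positive integer for \<open>0 < q < 1\<close>, as shown below.\<close>
definition k_q :: "real \<Rightarrow> nat" where
  "k_q q = nat \<lfloor>q / (1 - q) + eps q\<rfloor>"

lemma k_q_eq:
  assumes "0 < q" "q < 1"
  shows "real (k_q q) = q / (1 - q) + eps q" and "k_q q \<ge> 1"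
proof -
  have "q / (1 - q) > 0"
    using assms by simp
  then have pos: "\<lceil>q / (1 - q)\<rceil> \<ge> 1"
    by linarith
  have eq: "k_q q = nat \<lceil>q / (1 - q)\<rceil>"
    by (simp add: k_q_def eps_def)
  show "real (k_q q) = q / (1 - q) + eps q"
    unfolding eq eps_def using pos by (simp add: of_nat_nat)
  show "k_q q \<ge> 1"
    unfolding eq using pos by linarith
qed

end

theory Submission
  imports Defs
begin

text \<open>
  If \<open>m (1 - q) \<le> q\<close>, a lower player never competes with \<open>m\<close> rounds left: competing wins with
  probability at most \<open>1 / 2\<close>, and then yields at most \<open>m\<close> in total, whereas losing yields
  \<open>(m - 1) q\<close>; the average of these is at most the \<open>m q\<close> obtained by always taking the weaker
  candidate. The number \<open>k\<^sub>q\<close> is the least number of rounds for which this inequality can fail,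
  and it fails exactly when \<open>\<epsilon> > 0\<close>. So from equal reputations the players compete precisely in
  the first round and lose the welfare \<open>q\<close> once, which gives the ratio \<open>1 - q / (k\<^sub>q (1 + q))\<close>.
  Since \<open>k\<^sub>q (1 - q) = q + \<epsilon> (1 - q)\<close>, this tends to \<open>1 - (1 - q) / (1 + q)\<close>.
\<close>

lemma finite_set_pmf_round: "finite (set_pmf (round_pmf x a))"
  unfolding round_pmf_def winner_pmf_def by auto

lemma finite_set_pmf_play: "finite (set_pmf (play k x s))"
  by (induction k arbitrary: x s) (auto simp: finite_set_pmf_round)

lemma utility_0 [simp]: "utility q 0 x s i = 0"
  by (simp add: utility_def)

text \<open>The backward-induction recursion. The expectation can be split along the first outcome
  because all distributions involved have finite support.\<close>

lemma utility_Suc_first_then: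
  "utility q (Suc k) x (first_then a t) i =
     measure_pmf.expectation (round_pmf x a)
       (\<lambda>w. payoff q w i + utility q k (update x w) (t w) i)"
proof -
  have "integrable (play k (update x w) (t w)) (\<lambda>h. \<Sum>w\<leftarrow>h. payoff q w i)" for w
    by (intro integrable_measure_pmf_finite finite_set_pmf_play)
  then have "measure_pmf.expectation (play k (update x w) (t w))
      (\<lambda>h. payoff q w i + (\<Sum>w\<leftarrow>h. payoff q w i)) =
    payoff q w i + utility q k (update x w) (t w) i" for w
    by (simp add: utility_def)
  then show ?thesis
    unfolding utility_def play.simps
    by (subst pmf_expectation_bind[where A = "set_pmf (round_pmf x a)"])
      (auto simp: finite_set_pmf_round finite_set_pmf_play first_then_def
        integral_measure_pmf[where A = "set_pmf (round_pmf x a)"])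
qed

text \<open>Different offers make the round deterministic. The continuation depends only on the new
  reputations, as in \<open>canonical\<close>, so the outcome itself can be forgotten.\<close>

lemma utility_offer_weaker:
  "utility q (Suc k) x (first_then (offers x Weaker) (\<lambda>w. t (update x w))) i =
     (if i = higher x then 1 else q) +
     utility q k (x(higher x := Suc (x (higher x)))) (t (x(higher x := Suc (x (higher x))))) i"
proof -
  have "offers x Weaker P1 \<noteq> offers x Weaker P2"
    by (simp add: offers_def higher_def)
  moreover have "update x (\<lambda>i. Some (offers x Weaker i)) = x(higher x := Suc (x (higher x)))"
    by (auto simp: update_def offers_def)
  ultimately show ?thesis
    by (simp add: utility_Suc_first_then round_pmf_def payoff_def offers_def)
qed

text \<open>Positive total reputation makes the two winning chances add up to 1, so the expectation
  becomes a sum over the winner \<open>w\<close>.\<close>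

lemma utility_offer_stronger:
  assumes "x P1 + x P2 > 0"
  shows "utility q (Suc k) x (first_then (offers x Stronger) (\<lambda>w. t (update x w))) i =
     (\<Sum>w\<in>{P1, P2}. real (x w) / (real (x P1) + real (x P2)) *
        ((if i = w then 1 else 0) + utility q k (x(w := Suc (x w))) (t (x(w := Suc (x w)))) i))"
proof -
  define p where "p = real (x P1) / (real (x P1) + real (x P2))"
  have S: "real (x P1) + real (x P2) > 0"
    using assms by linarith
  then have p: "0 \<le> p" "p \<le> 1" and p': "real (x P2) / (real (x P1) + real (x P2)) = 1 - p"
    by (simp_all add: p_def diff_divide_eq_iff)
  have "update x (\<lambda>i. if i = w then Some Stronger else None) = x(w := Suc (x w))" for w
    by (auto simp: update_def)
  then show ?thesis
    using p by (simp add: utility_Suc_first_then round_pmf_def winner_pmf_def offers_def payoff_def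
        p' p_def[symmetric] if_distrib map_pmf_comp del: times_divide_eq_left)
qed

lemma canonical_Suc:
  "canonical q (Suc k) x =
     (let t = (\<lambda>w. canonical q k (update x w));
          v = (\<lambda>c. utility q (Suc k) x (first_then (offers x c) t) (lower x))
      in first_then (offers x (if v Stronger > v Weaker then Stronger else Weaker)) t)"
  by (simp add: lower_choice_def Let_def)

text \<open>Induction on \<open>m\<close>: since \<open>q < 1\<close>, the bound passes down to
  fewer rounds, and a higher player who hires the stronger candidate stays higher, so the roles
  never change.\<close>

lemma utility_canonical_no_competition:
  assumes "q < 1" "real m * (1 - q) \<le> q" "x P1 + x P2 > 0"
  shows "utility q m x (canonical q m x) i = real m * (if i = higher x then 1 else q)"
  using assms(2,3)
proof (induction m arbitrary: x i)
  case (Suc m)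
  have IH: "utility q m y (canonical q m y) j = real m * (if j = higher y then 1 else q)"
    if "y P1 + y P2 > 0" for y j
    using Suc.IH[of y j] Suc.prems(1) that \<open>q < 1\<close> by (simp add: algebra_simps)
  have winning: "higher (x(higher x := Suc (x (higher x)))) = higher x"
    by (auto simp: higher_def)
  define v where "v = (\<lambda>c j. utility q (Suc m) x
    (first_then (offers x c) (\<lambda>w. canonical q m (update x w))) j)"
  have weaker: "v Weaker j = real (Suc m) * (if j = higher x then 1 else q)" for j
    using Suc.prems(2) unfolding v_def utility_offer_weaker
    by (subst IH) (auto simp: winning algebra_simps higher_def)
  define p where "p = real (x (lower x)) / (real (x P1) + real (x P2))"
  have S: "real (x P1) + real (x P2) > 0"
    using Suc.prems(2) by linarith
  then have p: "0 \<le> p" "p \<le> 1 / 2" and p': "real (x (higher x)) / (real (x P1) + real (x P2)) = 1 - p"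
    by (simp_all add: p_def lower_def higher_def diff_divide_eq_iff divide_le_eq)
  define W where "W = utility q m (x(lower x := Suc (x (lower x))))
    (canonical q m (x(lower x := Suc (x (lower x))))) (lower x)"
  \<comment> \<open>A win may turn the lower player into the higher one, so the continuation is only
    bounded by 1 per round.\<close>
  have "W \<le> real m"
    using Suc.prems(2) \<open>q < 1\<close> unfolding W_def
    by (subst IH) (auto simp: mult_left_le)
  have lose: "utility q m (x(higher x := Suc (x (higher x))))
    (canonical q m (x(higher x := Suc (x (higher x))))) (lower x) = real m * q"
    using Suc.prems(2) by (subst IH) (auto simp: winning lower_def higher_def)
  have lower: "lower x \<noteq> higher x" "{P1, P2} = {lower x, higher x}"
    by (auto simp: lower_def higher_def)
  have "v Stronger (lower x) = p * (1 + W) + (1 - p) * (real m * q)"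
    using Suc.prems(2) lower(1) unfolding v_def utility_offer_stronger[OF Suc.prems(2)] lower(2)
    by (simp add: p_def[symmetric] p' W_def[symmetric] lose del: times_divide_eq_left)
  also have "\<dots> \<le> p * (1 + real m) + (1 - p) * (real m * q)"
    using \<open>W \<le> real m\<close> p by (simp add: mult_left_mono)
  also have "\<dots> = real m * q + p * (1 + real m * (1 - q))"
    by (simp add: algebra_simps)
  also have "\<dots> \<le> real m * q + 1 / 2 * (1 + real m * (1 - q))"
    using p \<open>q < 1\<close> by (intro add_left_mono mult_right_mono) auto
  \<comment> \<open>After rearranging, this is the premise
    \<open>real (Suc m) * (1 - q) \<le> q\<close>. A non-strict inequality suffices, since
    indifference selects the weaker candidate.\<close>
  also have "\<dots> \<le> v Weaker (lower x)"
    using Suc.prems(1) lower(1) by (simp add: weaker field_simps)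
  finally have "canonical q (Suc m) x = first_then (offers x Weaker) (\<lambda>w. canonical q m (update x w))"
    by (simp add: canonical_Suc v_def del: canonical.simps)
  then show ?case
    using weaker[of i] by (simp add: v_def del: canonical.simps)
qed simp

text \<open>The bounds on \<open>m\<close> say that competing pays at the tie with
  \<open>Suc m\<close> rounds left, but never afterwards.\<close>

lemma social_welfare_canonical_tie:
  assumes "q < 1" "real m * (1 - q) \<le> q" "real (Suc m) * (1 - q) > q" "x > 0"
  shows "social_welfare q (Suc m) (initial x x) (canonical q (Suc m) (initial x x)) =
    1 + real m * (1 + q)"
proof -
  define y where "y = initial x x"
  have y: "y P1 = x" "y P2 = x" and hl: "higher y = P1" "lower y = P2"
    by (simp_all add: y_def initial_def higher_def lower_def)
  have IH: "utility q m z (canonical q m z) j = real m * (if j = higher z then 1 else q)"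
    if "z P1 + z P2 > 0" for z j
    using utility_canonical_no_competition[of q m z j] assms that by simp
  define v where "v = (\<lambda>c j. utility q (Suc m) y
    (first_then (offers y c) (\<lambda>w. canonical q m (update y w))) j)"
  have half: "real x / (real x + real x) = 1 / 2"
    using \<open>x > 0\<close> by simp
  \<comment> \<open>A single win breaks the tie, so the winner of the first round takes the stronger
    candidate in all later rounds.\<close>
  have winner: "higher (y(P1 := Suc x)) = P1" "higher (y(P2 := Suc x)) = P2"
    by (simp_all add: higher_def y)
  have weaker: "v Weaker P2 = real (Suc m) * q"
    using \<open>x > 0\<close> unfolding v_def utility_offer_weaker hl
    by (subst IH) (auto simp: winner y algebra_simps)
  have "y P1 + y P2 > 0"
    using \<open>x > 0\<close> y by simp
  \<comment> \<open>Winning yields \<open>1 + real m\<close> and losing \<open>real m * q\<close>,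
    each with probability 1/2 for either player.\<close>
  from utility_offer_stronger[OF this]
  have stronger: "v Stronger j = 1 / 2 * (1 + real m * (1 + q))" for j
    using \<open>x > 0\<close> unfolding v_def
    by (cases j) (simp_all add: y half IH winner algebra_simps)
  have "v Stronger P2 > v Weaker P2"
    using assms(3) by (simp add: weaker stronger algebra_simps)
  then have "canonical q (Suc m) y = first_then (offers y Stronger) (\<lambda>w. canonical q m (update y w))"
    by (simp add: canonical_Suc v_def hl del: canonical.simps)
  then have "social_welfare q (Suc m) y (canonical q (Suc m) y) = v Stronger P1 + v Stronger P2"
    by (simp add: social_welfare_def v_def del: canonical.simps)
  then show ?thesis
    by (simp add: stronger y_def[symmetric] del: canonical.simps)
qed

lemma performance_ratio_k_q:
  assumes q: "0 < q" "q < 1" and "eps q > 0" "x > 0"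
  shows "performance_ratio (k_q q) q x x = 1 - q / (real (k_q q) * (1 + q))"
proof -
  obtain m where m: "k_q q = Suc m"
    using k_q_eq(2)[OF q] by (cases "k_q q") auto
  have k: "real (Suc m) * (1 - q) = q + eps q * (1 - q)"
    using k_q_eq(1)[OF q] q m by (simp add: field_simps)
  \<comment> \<open>This puts \<open>m\<close>, which is \<open>q / (1 - q) + eps q - 1\<close>,
    below the threshold \<open>q / (1 - q)\<close>.\<close>
  have "eps q < 1"
    unfolding eps_def by linarith
  then have "real m < q / (1 - q)"
    using k_q_eq(1)[OF q] m by simp
  then have "real m * (1 - q) \<le> q"
    using q by (simp add: field_simps)
  moreover have "real (Suc m) * (1 - q) > q"
    using k assms by simp
  ultimately have "performance_ratio (k_q q) q x x =
      (1 + real m * (1 + q)) / (real (Suc m) * (1 + q))"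
    unfolding performance_ratio_def m using social_welfare_canonical_tie[OF q(2)] \<open>x > 0\<close> by simp
  moreover have "1 + real m * (1 + q) = real (Suc m) * (1 + q) - q"
    by (simp add: algebra_simps)
  moreover have "real (Suc m) * (1 + q) \<noteq> 0"
    using q by simp
  ultimately show ?thesis
    unfolding m by (simp only: diff_divide_distrib divide_self_if if_False)
qed

theorem proposition3p3:
  shows "\<forall>\<delta>::real. \<delta> > 0 \<longrightarrow>
    (\<exists>\<epsilon>\<^sub>0::real. \<epsilon>\<^sub>0 > 0 \<and>
      (\<forall>q::real. 0 < q \<and> q < 1 \<and> 0 < eps q \<and> eps q < \<epsilon>\<^sub>0 \<longrightarrow>
        (\<forall>x::nat. x > 0 \<longrightarrow>
          \<bar>performance_ratio (k_q q) q x x - 2 * q / (1 + q)\<bar> < \<delta>)))"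
proof -
  \<comment> \<open>The bound \<open>eps q\<close> is uniform in \<open>q\<close> and
    \<open>x\<close>, so \<open>\<delta>\<close> itself serves as
    \<open>\<epsilon>\<^sub>0\<close>.\<close>
  have "\<bar>performance_ratio (k_q q) q x x - 2 * q / (1 + q)\<bar> \<le> eps q"
    if q: "0 < q" "q < 1" and "0 < eps q" "x > 0" for q x
  proof -
    define k where "k = real (k_q q)"
    have k: "k \<ge> 1" "k * (1 - q) = q + eps q * (1 - q)"
      using k_q_eq[OF q] q by (simp_all add: k_def field_simps)
    have "performance_ratio (k_q q) q x x - 2 * q / (1 + q) = (k * (1 - q) - q) / (k * (1 + q))"
    proof -
      have "k \<noteq> 0" "1 + q \<noteq> 0"
        using k(1) q by auto
      then show ?thesis
        unfolding performance_ratio_k_q[OF that] k_def[symmetric]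
        by (simp add: divide_simps) (simp add: algebra_simps)
    qed
    also have "\<dots> = eps q * ((1 - q) / (k * (1 + q)))"
      by (simp add: k(2))
    finally have eq: "performance_ratio (k_q q) q x x - 2 * q / (1 + q) =
      eps q * ((1 - q) / (k * (1 + q)))" .
    \<comment> \<open>The factor multiplying \<open>eps q\<close> lies between 0 and 1 because
      \<open>k \<ge> 1\<close>.\<close>
    have "1 - q \<le> 1 * (1 + q)"
      using q by simp
    also have "\<dots> \<le> k * (1 + q)"
      using k(1) q by (intro mult_right_mono) auto
    finally have "(1 - q) / (k * (1 + q)) \<le> 1" "(1 - q) / (k * (1 + q)) \<ge> 0"
      using k(1) q by (simp_all add: divide_simps)
    then show ?thesis
      unfolding eq using \<open>0 < eps q\<close> by (simp only: abs_of_nonneg mult_nonneg_nonneg mult_left_le less_imp_le)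
  qed
  then show ?thesis
    by (meson le_less_trans)
qed

end
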